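(* For any $\Lambda\subseteq \mathbb{Z}_{\ge 0}\times\mathbb{Z}_{\ge 0}$, the limit $\rho^\Lambda=\lim_{n\to\infty}\rho^\Lambda_n$ exists. It is positive as long as $\Lambda$ contains at least one element $(s,d)$ where $d$ is even. Furthermore, $$\rho^\Lambda=\sum_{(s,d)\in\Lambda}\rho^{s,d},$$ where $\rho^{s,d}$ denotes $\rho^{\{(s,d)\}}$.
   Context: For a finite set $S$ of integers, $S+S=\{s_1+s_2 : s_1,s_2\in S\}$ and $S-S=\{s_1-s_2 : s_1,s_2\in S\}$. For $S\subseteq\{0,1,\dots,n\}$ put $\lambda(S)=\lambda_n(S)=(2n+1-|S+S|,\;2n+1-|S-S|)$, the pair (number of missing sums, number of missing differences). For $\Lambda\subseteq\mathbb{Z}_{\ge 0}\times\mathbb{Z}_{\ge 0}$ (possibly infinite) put $\rho^\Lambda_n=2^{-n-1}\,|\{S\subseteq\{0,1,\dots,n\} : \lambda_n(S)\in\Lambda\}|$. *)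

theory Defs
  imports "HOL-Analysis.Infinite_Sum"
begin

definition sumset :: "int set \<Rightarrow> int set" where
  "sumset S = {s1 + s2 |s1 s2. s1 \<in> S \<and> s2 \<in> S}"

(* Written out because "S - S" on sets denotes the set-theoretic difference. *)
definition diffset :: "int set \<Rightarrow> int set" where
  "diffset S = {s1 - s2 |s1 s2. s1 \<in> S \<and> s2 \<in> S}"

(* The subtractions on nat never truncate for subsets of {0..n}:
   see card_sumset_le and card_diffset_le below. *)
definition missing :: "nat \<Rightarrow> int set \<Rightarrow> nat \<times> nat" where
  "missing n S = (2 * n + 1 - card (sumset S), 2 * n + 1 - card (diffset S))"

definition rho_fin :: "nat \<Rightarrow> (nat \<times> nat) set \<Rightarrow> real" where
  "rho_fin n \<Lambda> = real (card {S. S \<subseteq> {0..int n} \<and> missing n S \<in> \<Lambda>}) / 2 ^ (n + 1)"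

(* "lim" is an unspecified real when the sequence diverges, so statements about
   rho are meaningful only together with convergence of the sequence. *)
definition rho :: "(nat \<times> nat) set \<Rightarrow> real" where
  "rho \<Lambda> = lim (\<lambda>n. rho_fin n \<Lambda>)"

lemma card_sumset_le:
  assumes "S \<subseteq> {0..int n}"
  shows "card (sumset S) \<le> 2 * n + 1"
proof -
  have "sumset S \<subseteq> {0..2 * int n}"
  proof
    fix x assume "x \<in> sumset S"
    then obtain a b where "x = a + b" "a \<in> {0..int n}" "b \<in> {0..int n}"
      using assms unfolding sumset_def by blast
    then show "x \<in> {0..2 * int n}" by simp
  qed
  then have "card (sumset S) \<le> card {0..2 * int n}"
    by (intro card_mono) auto
  then show ?thesis by simp
qed

lemma card_diffset_le:
  assumes "S \<subseteq> {0..int n}"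
  shows "card (diffset S) \<le> 2 * n + 1"
proof -
  have "diffset S \<subseteq> {- int n..int n}"
  proof
    fix x assume "x \<in> diffset S"
    then obtain a b where "x = a - b" "a \<in> {0..int n}" "b \<in> {0..int n}"
      using assms unfolding diffset_def by blast
    then show "x \<in> {- int n..int n}" by simp
  qed
  then have "card (diffset S) \<le> card {- int n..int n}"
    by (intro card_mono) auto
  then show ?thesis by simp
qed

end

theory Submission imports Defs "HOL-Library.Set_Algebras" begin

text \<open>
  For a uniformly random subset S of {0..n}, a sum or difference at distance j from the nearest
  end of its range is missing with probability at most (3/4)^(j/2): it is represented by at least
  j/2 disjoint pairs, each of which lies in S with probability at least 1/4. Up to a probability
  that tends to 0 with K, uniformly in n, the missing sums and differences are therefore those
  caused by the two fringes A and B of length K (with B reflected): A + A and B + B account for the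
  missing sums, and A + B for half of the missing differences. The distribution of the pair
  (missing sums, missing differences) is thus uniformly approximated by distributions with finite
  support that do not depend on n, which gives both convergence and countable additivity.

  For positivity it suffices to find cofinite sets A and B of natural numbers for which A + A and
  B + B miss s numbers altogether and A + B misses d/2: such fringes can be attached to almost any
  S. If d \<le> s, take A to be 0 together with a final segment and B everything, and shift B. If
  d > s, take sets that are 8-periodic up to a point and full beyond it, whose residues P and Q
  satisfy P + P = Q + Q = Z/8 while P + Q misses one class, and shift B; if s is odd, P is chosen
  so that P + P moreover misses the integer 1.
\<close>

section \<open>Missing sums and differences read off from the two fringes\<close>

definition reflect :: "nat \<Rightarrow> int set \<Rightarrow> int set" where
  "reflect n S = (\<lambda>x. int n - x) ` S"

text \<open>The bounds are those at distance \<open>K\<close> from the ends of the full ranges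
  \<open>{0..2 * int n}\<close> and \<open>{- int n..int n}\<close>.\<close>

definition middle_full :: "nat \<Rightarrow> nat \<Rightarrow> int set \<Rightarrow> bool" where
  "middle_full K n S \<longleftrightarrow> {int K..2 * int n - int K} \<subseteq> sumset S
    \<and> {int K - int n..int n - int K} \<subseteq> diffset S"

text \<open>\<open>A\<close> stands for the left end of a set and \<open>B\<close> for its reflected
  right end, so both are sets of small nonnegative integers. The factor 2 reflects the symmetry of
  the difference set: each gap of \<open>A + B\<close> costs a difference and its negative.\<close>

definition fringe_missing :: "nat \<Rightarrow> int set \<Rightarrow> int set \<Rightarrow> nat \<times> nat" where
  "fringe_missing K A B =
    (card ({0..<int K} - (A + A)) + card ({0..<int K} - (B + B)),
     2 * card ({0..<int K} - (A + B)))"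

lemma sumset_eq_plus: "sumset S = S + S"
  unfolding sumset_def set_plus_def by blast

lemma mem_reflect_iff: "x \<in> reflect n S \<longleftrightarrow> int n - x \<in> S"
proof
  assume "int n - x \<in> S"
  then have "int n - (int n - x) \<in> reflect n S" unfolding reflect_def by (rule imageI)
  then show "x \<in> reflect n S" by simp
qed (auto simp: reflect_def)

lemma mem_reflect_plus_reflect_iff:
  "k \<in> reflect n S + reflect n S \<longleftrightarrow> 2 * int n - k \<in> sumset S"
proof
  assume "k \<in> reflect n S + reflect n S"
  then obtain x y where "k = x + y" "int n - x \<in> S" "int n - y \<in> S"
    by (auto simp: set_plus_def mem_reflect_iff)
  then show "2 * int n - k \<in> sumset S" unfolding sumset_def
    by (intro CollectI exI[of _ "int n - x"] exI[of _ "int n - y"]) auto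
next
  assume "2 * int n - k \<in> sumset S"
  then obtain a b where ab: "2 * int n - k = a + b" "a \<in> S" "b \<in> S" by (auto simp: sumset_def)
  then have "k = (int n - a) + (int n - b)" "int n - a \<in> reflect n S" "int n - b \<in> reflect n S"
    by (simp_all add: mem_reflect_iff)
  then show "k \<in> reflect n S + reflect n S" by (metis set_plus_intro)
qed

text \<open>Differences become sums through b + (n - a) = n - (a - b); the largest differences
  correspond to the smallest elements of the sum.\<close>

lemma mem_plus_reflect_iff: "k \<in> S + reflect n S \<longleftrightarrow> int n - k \<in> diffset S"
proof
  assume "k \<in> S + reflect n S"
  then obtain x y where "k = x + y" "x \<in> S" "int n - y \<in> S"
    by (auto simp: set_plus_def mem_reflect_iff)
  then show "int n - k \<in> diffset S" unfolding diffset_def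
    by (intro CollectI exI[of _ "int n - y"] exI[of _ x]) auto
next
  assume "int n - k \<in> diffset S"
  then obtain a b where ab: "int n - k = a - b" "a \<in> S" "b \<in> S" by (auto simp: diffset_def)
  then have "k = b + (int n - a)" "int n - a \<in> reflect n S"
    by (simp_all add: mem_reflect_iff)
  then show "k \<in> S + reflect n S" using ab by (metis set_plus_intro)
qed

lemma uminus_mem_diffset_iff: "- k \<in> diffset S \<longleftrightarrow> k \<in> diffset S"
proof -
  have "- k \<in> diffset S" if "k \<in> diffset S" for k
    using that unfolding diffset_def by force
  from this[of k] this[of "- k"] show ?thesis by auto
qed

text \<open>With a full middle, every missing value lies within \<open>K\<close> of an end of its
  range. Missing sums at the right end become small gaps after reflection; missing differences at
  both ends are copies of the same set \<open>?D\<close>.\<close>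

lemma missing_eq_fringe_missing:
  assumes S: "S \<subseteq> {0..int n}" and "K \<le> n" and full: "middle_full K n S"
  shows "missing n S = fringe_missing K S (reflect n S)"
proof -
  let ?L = "{0..<int K} - (S + S)"
  let ?R = "{0..<int K} - (reflect n S + reflect n S)"
  let ?D = "{0..<int K} - (S + reflect n S)"
  have sub: "sumset S \<subseteq> {0..2 * int n}" "diffset S \<subseteq> {- int n..int n}"
    by (force simp: sumset_def diffset_def dest!: subsetD[OF S])+
  have "{0..2 * int n} - sumset S = ?L \<union> (\<lambda>k. 2 * int n - k) ` ?R"
  proof (intro set_eqI iffI)
    fix k assume k: "k \<in> {0..2 * int n} - sumset S"
    have "k \<notin> {int K..2 * int n - int K}"
      using k full unfolding middle_full_def by blast
    then consider "k < int K" | "k > 2 * int n - int K" by force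
    then show "k \<in> ?L \<union> (\<lambda>k. 2 * int n - k) ` ?R"
    proof cases
      case 1 then show ?thesis using k by (auto simp: sumset_eq_plus)
    next
      case 2
      then have "2 * int n - k \<in> ?R" using k by (auto simp: mem_reflect_plus_reflect_iff)
      then have "2 * int n - (2 * int n - k) \<in> (\<lambda>k. 2 * int n - k) ` ?R" by (rule imageI)
      then show ?thesis by simp
    qed
  qed (use \<open>K \<le> n\<close> in \<open>auto simp: sumset_eq_plus mem_reflect_plus_reflect_iff\<close>)
  \<comment> \<open>Elements of the left part are below K, those of the right part exceed 2n - K,
    and K <= n gives K <= 2n - K.\<close>
  moreover have "?L \<inter> (\<lambda>k. 2 * int n - k) ` ?R = {}" using \<open>K \<le> n\<close> by auto
  ultimately have "card ({0..2 * int n} - sumset S) = card ?L + card ((\<lambda>k. 2 * int n - k) ` ?R)"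
    by (simp add: card_Un_disjoint)
  also have "card ((\<lambda>k. 2 * int n - k) ` ?R) = card ?R" by (intro card_image inj_onI) simp
  finally have sums: "2 * n + 1 - card (sumset S) = card ?L + card ?R"
    using card_Diff_subset[OF finite_subset[OF sub(1)] sub(1)] by simp
  have "{- int n..int n} - diffset S = (\<lambda>k. int n - k) ` ?D \<union> (\<lambda>k. k - int n) ` ?D"
  proof (intro set_eqI iffI)
    fix k assume k: "k \<in> {- int n..int n} - diffset S"
    have "k \<notin> {int K - int n..int n - int K}"
      using k full unfolding middle_full_def by blast
    then consider "k < int K - int n" | "k > int n - int K" by force
    then show "k \<in> (\<lambda>k. int n - k) ` ?D \<union> (\<lambda>k. k - int n) ` ?D"
    proof cases
      case 1
      then have "k + int n \<in> ?D" using k uminus_mem_diffset_iff[of k S]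
        by (auto simp: mem_plus_reflect_iff)
      then have "k + int n - int n \<in> (\<lambda>k. k - int n) ` ?D" by (rule imageI)
      then show ?thesis by simp
    next
      case 2
      then have "int n - k \<in> ?D" using k by (auto simp: mem_plus_reflect_iff)
      then have "int n - (int n - k) \<in> (\<lambda>k. int n - k) ` ?D" by (rule imageI)
      then show ?thesis by simp
    qed
  next
    fix k assume "k \<in> (\<lambda>k. int n - k) ` ?D \<union> (\<lambda>k. k - int n) ` ?D"
    then show "k \<in> {- int n..int n} - diffset S"
      using \<open>K \<le> n\<close> uminus_mem_diffset_iff[of k S] by (auto simp: mem_plus_reflect_iff)
  qed
  moreover have "(\<lambda>k. int n - k) ` ?D \<inter> (\<lambda>k. k - int n) ` ?D = {}" using \<open>K \<le> n\<close> by auto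
  ultimately have "card ({- int n..int n} - diffset S)
      = card ((\<lambda>k. int n - k) ` ?D) + card ((\<lambda>k. k - int n) ` ?D)"
    by (simp add: card_Un_disjoint)
  also have "card ((\<lambda>k. int n - k) ` ?D) = card ?D" by (intro card_image inj_onI) simp
  also have "card ((\<lambda>k. k - int n) ` ?D) = card ?D" by (intro card_image inj_onI) simp
  finally have "2 * n + 1 - card (diffset S) = 2 * card ?D"
    using card_Diff_subset[OF finite_subset[OF sub(2)] sub(2)] by (simp add: nat_add_distrib nat_mult_distrib)
  with sums show ?thesis by (simp add: missing_def fringe_missing_def)
qed

text \<open>If a sum of two nonnegative integers is below \<open>K\<close>, so are both
  summands.\<close>

lemma fringe_missing_cong:
  assumes nonneg: "A \<subseteq> {0..}" "B \<subseteq> {0..}" "A' \<subseteq> {0..}" "B' \<subseteq> {0..}"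
    and eq: "A \<inter> {0..<int K} = A' \<inter> {0..<int K}" "B \<inter> {0..<int K} = B' \<inter> {0..<int K}"
  shows "fringe_missing K A B = fringe_missing K A' B'"
proof -
  have "{0..<int K} - (X + Y) = {0..<int K} - (X \<inter> {0..<int K} + Y \<inter> {0..<int K})"
    if "X \<subseteq> {0..}" "Y \<subseteq> {0..}" for X Y
  proof -
    have "k \<in> X \<inter> {0..<int K} + Y \<inter> {0..<int K}" if k: "k < int K" "k \<in> X + Y" for k
    proof -
      from k obtain x y where "k = x + y" "x \<in> X" "y \<in> Y" by (auto simp: set_plus_def)
      then show ?thesis using k(1) \<open>X \<subseteq> {0..}\<close> \<open>Y \<subseteq> {0..}\<close>
        by (intro set_plus_intro[of x _ y, folded \<open>k = x + y\<close>]) force+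
    qed
    moreover have "X \<inter> {0..<int K} + Y \<inter> {0..<int K} \<subseteq> X + Y"
      by (intro set_plus_mono2) auto
    ultimately show ?thesis by auto
  qed
  note restrict = this
  show ?thesis unfolding fringe_missing_def
    by (simp only: restrict[OF nonneg(1) nonneg(1)] restrict[OF nonneg(2) nonneg(2)]
        restrict[OF nonneg(1,2)] restrict[OF nonneg(3) nonneg(3)]
        restrict[OF nonneg(4) nonneg(4)] restrict[OF nonneg(3,4)] eq)
qed

section \<open>Exponential bounds for a missing sum or difference\<close>

text \<open>For a uniformly random S the events that S contains \<open>E i\<close> are independent,
  because the \<open>E i\<close> are disjoint, and each has probability at least 1/4. The induction
  splits S into its trace on one \<open>E i\<close> and the rest.\<close>

lemma card_subsets_avoiding_le:
  fixes E :: "'i \<Rightarrow> 'a set"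
  assumes "finite I" "finite U" "disjoint_family_on E I"
    and "\<And>i. i \<in> I \<Longrightarrow> E i \<subseteq> U \<and> card (E i) \<le> 2"
  shows "real (card {S. S \<subseteq> U \<and> (\<forall>i\<in>I. \<not> E i \<subseteq> S)}) \<le> (3/4) ^ card I * 2 ^ card U"
  using assms
proof (induction I arbitrary: U rule: finite_induct)
  case empty
  then show ?case by (simp add: card_Pow flip: Pow_def)
next
  case (insert i I)
  let ?F = "{S. S \<subseteq> U - E i \<and> (\<forall>j\<in>I. \<not> E j \<subseteq> S)}"
  let ?G = "{S. S \<subseteq> U \<and> (\<forall>j\<in>insert i I. \<not> E j \<subseteq> S)}"
  have Ei: "E i \<subseteq> U" "card (E i) \<le> 2" "finite (E i)"
    using insert.prems by (auto intro: finite_subset)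
  have "E j \<inter> E i = {}" if "j \<in> I" for j
    using insert.prems(2) insert.hyps(2) that by (auto simp: disjoint_family_on_def)
  then have IH: "real (card ?F) \<le> (3/4) ^ card I * 2 ^ card (U - E i)"
    using insert.prems by (intro insert.IH) (auto simp: disjoint_family_on_def)
  have finF: "finite ?F" using insert.prems(1) by auto
  \<comment> \<open>The trace on \<open>E i\<close> may be any subset except \<open>E i\<close>
    itself.\<close>
  have "card ?G \<le> card ((Pow (E i) - {E i}) \<times> ?F)"
  proof (rule card_inj_on_le)
    show "inj_on (\<lambda>S. (S \<inter> E i, S - E i)) ?G"
      by (rule inj_onI) blast
    show "(\<lambda>S. (S \<inter> E i, S - E i)) ` ?G \<subseteq> (Pow (E i) - {E i}) \<times> ?F"
      by blast
  qed (use finF Ei in auto)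
  also have "\<dots> = (2 ^ card (E i) - 1) * card ?F"
    using Ei by (simp add: card_cartesian_product card_Diff_singleton card_Pow)
  finally have "real (card ?G) \<le> (2 ^ card (E i) - 1) * real (card ?F)"
    by (simp add: of_nat_diff flip: of_nat_le_iff[where 'a=real])
  also have "\<dots> \<le> (3/4 * 2 ^ card (E i)) * ((3/4) ^ card I * 2 ^ card (U - E i))"
  proof (rule mult_mono[OF _ IH])
    \<comment> \<open>The claim amounts to \<open>2 ^ card (E i) \<le> 4\<close>, which is where the
      size bound 2 enters.\<close>
    have "(2::real) ^ card (E i) \<le> 2 ^ 2" using Ei by (intro power_increasing) auto
    then show "(2::real) ^ card (E i) - 1 \<le> 3/4 * 2 ^ card (E i)" by simp
  qed auto
  also have "\<dots> = (3/4) ^ card (insert i I) * 2 ^ (card (E i) + card (U - E i))"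
    using insert.hyps by (simp add: power_add)
  also have "card (E i) + card (U - E i) = card U"
    using Ei insert.prems(1) by (simp add: card_Diff_subset card_mono)
  finally show ?case .
qed

lemma power_three_quarters_le:
  assumes "j \<le> 2 * m"
  shows "(3/4 :: real) ^ m \<le> sqrt (3/4) ^ j"
proof -
  have "(3/4 :: real) ^ m = sqrt (3/4) ^ (2 * m)" by (simp add: power_mult)
  also have "\<dots> \<le> sqrt (3/4) ^ j" using assms by (intro power_decreasing) auto
  finally show ?thesis .
qed

text \<open>The parameter a serves both ends: a = 0 gives the sum j, and a = n - j gives 2n - j. The
  pairs {x, 2a + j - x} lie in {a..a + j} and are disjoint for x up to the midpoint.\<close>

lemma card_subsets_missing_sum_le:
  assumes "a + j \<le> n"
  shows "real (card {S. S \<subseteq> {0..int n} \<and> 2 * int a + int j \<notin> sumset S}) \<le> sqrt (3/4) ^ j * 2 ^ (n + 1)"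
proof -
  \<comment> \<open>For even j the last pair collapses to a singleton, which
    \<open>card_subsets_avoiding_le\<close> permits.\<close>
  let ?I = "{a..a + j div 2}"
  let ?E = "\<lambda>x. {int x, 2 * int a + int j - int x}"
  have "{S. S \<subseteq> {0..int n} \<and> 2 * int a + int j \<notin> sumset S}
      \<subseteq> {S. S \<subseteq> {0..int n} \<and> (\<forall>x\<in>?I. \<not> ?E x \<subseteq> S)}" (is "?A \<subseteq> ?B")
  proof clarify
    fix S x assume "2 * int a + int j \<notin> sumset S" "?E x \<subseteq> S"
    moreover have "2 * int a + int j = int x + (2 * int a + int j - int x)" by simp
    ultimately show False unfolding sumset_def by blast
  qed
  then have "real (card ?A) \<le> real (card ?B)" by (intro of_nat_mono card_mono) auto
  also have "\<dots> \<le> (3/4) ^ card ?I * 2 ^ card {0..int n}"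
  proof (rule card_subsets_avoiding_le)
    show "disjoint_family_on ?E ?I" unfolding disjoint_family_on_def by auto
    show "?E x \<subseteq> {0..int n} \<and> card (?E x) \<le> 2" if "x \<in> ?I" for x
      using that assms by (auto simp: card_insert_if)
  qed auto
  also have "\<dots> \<le> sqrt (3/4) ^ j * 2 ^ (n + 1)"
    by (intro mult_mono power_three_quarters_le) (auto simp: nat_add_distrib)
  finally show ?thesis .
qed

text \<open>The pairs {x, x + d} overlap along progressions of step d. Cutting the integers into
  blocks of length d and letting x run through every other block makes the pairs disjoint and keeps
  at least half of them.\<close>

lemma card_subsets_missing_diff_le:
  assumes "j \<le> n"
  shows "real (card {S. S \<subseteq> {0..int n} \<and> int n - int j \<notin> diffset S}) \<le> sqrt (3/4) ^ j * 2 ^ (n + 1)"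
proof -
  define d where "d = n - j"
  \<comment> \<open>If d = 0, then \<open>x div d\<close> is 0, so \<open>?I\<close> is all of
    \<open>{..j}\<close> and the pairs are singletons.\<close>
  let ?I = "{x. x \<le> j \<and> even (x div d)}"
  let ?O = "{x. x \<le> j \<and> odd (x div d)}"
  let ?E = "\<lambda>x. {int x, int x + int d}"
  have d: "int n - int j = int d" "j + d = n" using assms by (auto simp: d_def)
  have "{S. S \<subseteq> {0..int n} \<and> int n - int j \<notin> diffset S}
      \<subseteq> {S. S \<subseteq> {0..int n} \<and> (\<forall>x\<in>?I. \<not> ?E x \<subseteq> S)}" (is "?A \<subseteq> ?B")
  proof clarify
    fix S x assume "int n - int j \<notin> diffset S" "?E x \<subseteq> S"
    moreover have "int n - int j = (int x + int d) - int x" using d by simp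
    ultimately show False unfolding diffset_def by blast
  qed
  then have "real (card ?A) \<le> real (card ?B)" by (intro of_nat_mono card_mono) auto
  also have "\<dots> \<le> (3/4) ^ card ?I * 2 ^ card {0..int n}"
  proof (rule card_subsets_avoiding_le)
    have ne: "int x \<noteq> int y + int d" if "even (x div d)" "even (y div d)" "x \<noteq> y" for x y
    proof
      assume "int x = int y + int d"
      then have "x = y + d" by linarith
      then show False using that by (cases "d = 0") auto
    qed
    have "?E x \<inter> ?E y = {}" if "x \<in> ?I" "y \<in> ?I" "x \<noteq> y" for x y
      using ne[of x y] ne[of y x] that by auto
    then show "disjoint_family_on ?E ?I" unfolding disjoint_family_on_def by blast
    show "?E x \<subseteq> {0..int n} \<and> card (?E x) \<le> 2" if "x \<in> ?I" for x
      using that d by (auto simp: card_insert_if)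
  qed auto
  also have "\<dots> \<le> sqrt (3/4) ^ j * 2 ^ (n + 1)"
  proof (intro mult_mono power_three_quarters_le)
    \<comment> \<open>Stepping back by d maps each odd block into the preceding even block.\<close>
    have "card ?O \<le> card ?I"
    proof (rule card_inj_on_le[where f = "\<lambda>x. x - d"])
      have ge: "d \<le> x" if "odd (x div d)" for x
        using that by (metis div_less even_zero linorder_not_less)
      then show "inj_on (\<lambda>x. x - d) ?O" by (auto simp: inj_on_def) (metis le_add_diff_inverse2)
      show "(\<lambda>x. x - d) ` ?O \<subseteq> ?I"
      proof clarify
        fix x assume x: "x \<le> j" "odd (x div d)"
        then have "d \<noteq> 0" by (cases d) auto
        then have "x div d = Suc ((x - d) div d)" using ge[OF x(2)] by (simp add: le_div_geq)
        then show "x - d \<le> j \<and> even ((x - d) div d)" using x by auto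
      qed
    qed auto
    moreover have "card ?I + card ?O = card (?I \<union> ?O)" by (subst card_Un_disjoint) auto
    moreover have "?I \<union> ?O = {..j}" by auto
    ultimately show "j \<le> 2 * card ?I" by simp
  qed (auto simp: nat_add_distrib)
  finally show ?thesis .
qed

text \<open>Sum of the geometric series with terms \<open>3 * sqrt (3/4) ^ j\<close> over j from K
  on; the 3 counts small sums, large sums and differences.\<close>

definition tail :: "nat \<Rightarrow> real" where
  "tail K = 3 * sqrt (3/4) ^ K / (1 - sqrt (3/4))"

lemma tail_tendsto_0: "tail \<longlonglongrightarrow> 0"
proof -
  have "(\<lambda>K. 3 * sqrt (3/4) ^ K / (1 - sqrt (3/4))) \<longlonglongrightarrow> 3 * 0 / (1 - sqrt (3/4))"
    by (intro tendsto_intros LIMSEQ_realpow_zero) auto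
  then show ?thesis by (simp add: tail_def[abs_def])
qed

text \<open>A union bound over the distance j from the end. Negative differences need no events of
  their own, by symmetry of the difference set.\<close>

lemma card_not_middle_full_le:
  shows "real (card {S. S \<subseteq> {0..int n} \<and> \<not> middle_full K n S}) \<le> tail K * 2 ^ (n + 1)"
proof -
  \<comment> \<open>The targets are written in the form 2a + j of
    \<open>card_subsets_missing_sum_le\<close>, with a = 0 here and a = n - j in
    \<open>?Y\<close>.\<close>
  let ?X = "\<lambda>j. {S. S \<subseteq> {0..int n} \<and> 2 * int 0 + int j \<notin> sumset S}"
  let ?Y = "\<lambda>j. {S. S \<subseteq> {0..int n} \<and> 2 * int (n - j) + int j \<notin> sumset S}"
  let ?Z = "\<lambda>j. {S. S \<subseteq> {0..int n} \<and> int n - int j \<notin> diffset S}"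
  have fin: "finite {S. S \<subseteq> {0..int n} \<and> P S}" for P by simp
  have "S \<in> (\<Union>j\<in>{K..n}. ?X j \<union> ?Y j \<union> ?Z j)" if S: "S \<subseteq> {0..int n}" "\<not> middle_full K n S" for S
  proof -
    from S(2) consider k where "int K \<le> k" "k \<le> int n" "k \<notin> sumset S"
      | k where "int n \<le> k" "k \<le> 2 * int n - int K" "k \<notin> sumset S"
      | k where "0 \<le> k" "k \<le> int n - int K" "k \<notin> diffset S"
      | k where "0 \<le> - k" "- k \<le> int n - int K" "- k \<notin> diffset S"
    proof -
      from S(2) obtain k where "k \<in> {int K..2 * int n - int K} \<and> k \<notin> sumset S
          \<or> k \<in> {int K - int n..int n - int K} \<and> k \<notin> diffset S \<and> - k \<notin> diffset S"
        unfolding middle_full_def uminus_mem_diffset_iff by blast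
      then show thesis using that(1)[of k] that(2)[of k] that(3)[of k] that(4)[of k]
        by (smt (verit) atLeastAtMost_iff)
    qed
    then show ?thesis
    proof cases
      case 1
      with S show ?thesis by (intro UN_I[of "nat k"]) auto
    next
      case 2
      then have "2 * int (n - nat (2 * int n - k)) + int (nat (2 * int n - k)) = k" by auto
      with 2 S show ?thesis by (intro UN_I[of "nat (2 * int n - k)"]) auto
    next
      case 3
      with S show ?thesis by (intro UN_I[of "nat (int n - k)"]) auto
    next
      case 4
      with S show ?thesis by (intro UN_I[of "nat (int n + k)"]) auto
    qed
  qed
  then have "card {S. S \<subseteq> {0..int n} \<and> \<not> middle_full K n S} \<le> card (\<Union>j\<in>{K..n}. ?X j \<union> ?Y j \<union> ?Z j)"
    using fin by (intro card_mono) auto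
  also have "\<dots> \<le> (\<Sum>j\<in>{K..n}. card (?X j \<union> ?Y j \<union> ?Z j))"
    by (intro card_UN_le) auto
  also have "\<dots> \<le> (\<Sum>j\<in>{K..n}. card (?X j) + card (?Y j) + card (?Z j))"
    by (intro sum_mono order.trans[OF card_Un_le] add_mono card_Un_le order.refl)
  finally have "real (card {S. S \<subseteq> {0..int n} \<and> \<not> middle_full K n S})
      \<le> real (\<Sum>j\<in>{K..n}. card (?X j) + card (?Y j) + card (?Z j))"
    by (rule of_nat_mono)
  also have "\<dots> = (\<Sum>j\<in>{K..n}. real (card (?X j)) + real (card (?Y j)) + real (card (?Z j)))"
    by (simp only: of_nat_sum of_nat_add)
  also have "\<dots> \<le> (\<Sum>j\<in>{K..n}. 3 * (sqrt (3/4) ^ j * 2 ^ (n + 1)))"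
  proof (rule sum_mono)
    fix j assume "j \<in> {K..n}"
    then have "real (card (?X j)) \<le> sqrt (3/4) ^ j * 2 ^ (n + 1)"
      "real (card (?Y j)) \<le> sqrt (3/4) ^ j * 2 ^ (n + 1)"
      "real (card (?Z j)) \<le> sqrt (3/4) ^ j * 2 ^ (n + 1)"
      by (intro card_subsets_missing_sum_le card_subsets_missing_diff_le; simp)+
    then show "real (card (?X j)) + real (card (?Y j)) + real (card (?Z j))
        \<le> 3 * (sqrt (3/4) ^ j * 2 ^ (n + 1))" by linarith
  qed
  also have "\<dots> = 3 * 2 ^ (n + 1) * (\<Sum>j\<in>{K..n}. sqrt (3/4) ^ j)"
    by (simp add: sum_distrib_left mult_ac)
  also have "\<dots> \<le> 3 * 2 ^ (n + 1) * (sqrt (3/4) ^ K / (1 - sqrt (3/4)))"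
  proof (intro mult_left_mono)
    show "(\<Sum>j\<in>{K..n}. sqrt (3/4) ^ j :: real) \<le> sqrt (3/4) ^ K / (1 - sqrt (3/4))"
      by (auto simp: sum_gp intro!: divide_right_mono)
  qed simp
  finally show ?thesis by (simp add: tail_def mult_ac)
qed

section \<open>Uniform approximation by the fringe distribution\<close>

text \<open>As 2K <= n, the two fringes and the middle \<open>?M\<close> partition
  \<open>{0..int n}\<close>, so they can be chosen independently; the middle has n + 1 - 2K
  elements.\<close>

lemma card_subsets_by_fringes:
  assumes "2 * K \<le> n"
  shows "card {S. S \<subseteq> {0..int n} \<and> P (S \<inter> {0..<int K}) (reflect n S \<inter> {0..<int K})}
    = card {(A, B). A \<subseteq> {0..<int K} \<and> B \<subseteq> {0..<int K} \<and> P A B} * 2 ^ (n + 1 - 2 * K)"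
proof -
  let ?F = "{0..<int K}" and ?M = "{int K..int n - int K}"
  let ?X = "{S. S \<subseteq> {0..int n} \<and> P (S \<inter> ?F) (reflect n S \<inter> ?F)}"
  let ?Y = "{(A, B). A \<subseteq> ?F \<and> B \<subseteq> ?F \<and> P A B} \<times> Pow ?M"
  let ?f = "\<lambda>S. ((S \<inter> ?F, reflect n S \<inter> ?F), S \<inter> ?M)"
  let ?g = "\<lambda>((A, B), M). A \<union> M \<union> reflect n B"
  have fringes: "(A \<union> M \<union> reflect n B) \<inter> ?F = A" "reflect n (A \<union> M \<union> reflect n B) \<inter> ?F = B"
      "(A \<union> M \<union> reflect n B) \<inter> ?M = M" "A \<union> M \<union> reflect n B \<subseteq> {0..int n}"
    if "A \<subseteq> ?F" "B \<subseteq> ?F" "M \<subseteq> ?M" for A B M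
  proof -
    have A: "0 \<le> x \<and> x < int K" if "x \<in> A" for x using \<open>A \<subseteq> ?F\<close> that by auto
    have B: "0 \<le> x \<and> x < int K" if "x \<in> B" for x using \<open>B \<subseteq> ?F\<close> that by auto
    have M: "int K \<le> x \<and> x \<le> int n - int K" if "x \<in> M" for x using \<open>M \<subseteq> ?M\<close> that by auto
    have "(x \<in> A \<or> x \<in> M \<or> int n - x \<in> B) \<and> 0 \<le> x \<and> x < int K \<longleftrightarrow> x \<in> A"
      "(int n - x \<in> A \<or> int n - x \<in> M \<or> x \<in> B) \<and> 0 \<le> x \<and> x < int K \<longleftrightarrow> x \<in> B"
      "(x \<in> A \<or> x \<in> M \<or> int n - x \<in> B) \<and> int K \<le> x \<and> x \<le> int n - int K \<longleftrightarrow> x \<in> M"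
      "x \<in> A \<or> x \<in> M \<or> int n - x \<in> B \<longrightarrow> 0 \<le> x \<and> x \<le> int n" for x
      using A[of x] A[of "int n - x"] B[of x] B[of "int n - x"] M[of x] M[of "int n - x"] assms by auto
    then show "(A \<union> M \<union> reflect n B) \<inter> ?F = A" "reflect n (A \<union> M \<union> reflect n B) \<inter> ?F = B"
      "(A \<union> M \<union> reflect n B) \<inter> ?M = M" "A \<union> M \<union> reflect n B \<subseteq> {0..int n}"
      by (simp_all add: set_eq_iff subset_iff mem_reflect_iff disj_assoc)
  qed
  have "bij_betw ?f ?X ?Y"
  proof (rule bij_betw_byWitness[where f' = ?g])
    show "\<forall>S\<in>?X. ?g (?f S) = S"
      using assms by (auto simp: mem_reflect_iff)
    show "\<forall>y\<in>?Y. ?f (?g y) = y" using fringes by auto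
    show "?f ` ?X \<subseteq> ?Y" by auto
    show "?g ` ?Y \<subseteq> ?X"
    proof clarify
      fix A B M assume "A \<subseteq> ?F" "B \<subseteq> ?F" "P A B" "M \<subseteq> ?M"
      then show "A \<union> M \<union> reflect n B \<subseteq> {0..int n} \<and> P ((A \<union> M \<union> reflect n B) \<inter> ?F)
          (reflect n (A \<union> M \<union> reflect n B) \<inter> ?F)"
        by (simp only: fringes simp_thms)
    qed
  qed
  then have "card ?X = card ?Y" by (rule bij_betw_same_card)
  moreover have "card ?M = n + 1 - 2 * K" using assms by simp
  then have "card ?Y = card {(A, B). A \<subseteq> ?F \<and> B \<subseteq> ?F \<and> P A B} * 2 ^ (n + 1 - 2 * K)"
    by (simp add: card_cartesian_product card_Pow del: card_atLeastAtMost_int)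
  ultimately show ?thesis by simp
qed

text \<open>The law of \<open>fringe_missing K\<close> for two independent uniform subsets of
  \<open>{0..<int K}\<close>. It is free of n, which makes it a common reference for all large
  n.\<close>

definition fringe_prob :: "nat \<Rightarrow> (nat \<times> nat) set \<Rightarrow> real" where
  "fringe_prob K \<Lambda> = real (card {(A, B). A \<subseteq> {0..<int K} \<and> B \<subseteq> {0..<int K}
    \<and> fringe_missing K A B \<in> \<Lambda>}) / 4 ^ K"

text \<open>The true and the fringe count differ only on sets whose middle is not full. The error
  depends neither on n nor on \<Lambda>; the first gives convergence, the second countable
  additivity.\<close>

lemma rho_fin_approx:
  assumes "2 * K \<le> n"
  shows "\<bar>rho_fin n \<Lambda> - fringe_prob K \<Lambda>\<bar> \<le> tail K"
proof -
  let ?X = "{S. S \<subseteq> {0..int n} \<and> missing n S \<in> \<Lambda>}"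
  let ?Y = "{S. S \<subseteq> {0..int n} \<and> fringe_missing K S (reflect n S) \<in> \<Lambda>}"
  let ?bad = "{S. S \<subseteq> {0..int n} \<and> \<not> middle_full K n S}"
  let ?F = "{0..<int K}"
  let ?c = "card {(A, B). A \<subseteq> ?F \<and> B \<subseteq> ?F \<and> fringe_missing K A B \<in> \<Lambda>}"
  have fin: "finite ?X" "finite ?Y" "finite ?bad" by auto
  have agree: "missing n S = fringe_missing K S (reflect n S)"
    if "S \<subseteq> {0..int n}" "middle_full K n S" for S
    using that assms by (intro missing_eq_fringe_missing) auto
  have "?X \<subseteq> ?Y \<union> ?bad" "?Y \<subseteq> ?X \<union> ?bad" using agree by auto
  then have "card ?X \<le> card ?Y + card ?bad" "card ?Y \<le> card ?X + card ?bad"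
    using fin by (metis (no_types, lifting) card_mono card_Un_le finite_UnI le_trans)+
  then have "\<bar>real (card ?X) - real (card ?Y)\<bar> \<le> real (card ?bad)" by linarith
  also have "\<dots> \<le> tail K * 2 ^ (n + 1)" by (rule card_not_middle_full_le)
  finally have diff: "\<bar>real (card ?X) - real (card ?Y)\<bar> \<le> tail K * 2 ^ (n + 1)" .
  have "fringe_missing K S (reflect n S) = fringe_missing K (S \<inter> ?F) (reflect n S \<inter> ?F)"
    if "S \<subseteq> {0..int n}" for S
    using that by (intro fringe_missing_cong) (auto simp: mem_reflect_iff)
  then have "?Y = {S. S \<subseteq> {0..int n} \<and> fringe_missing K (S \<inter> ?F) (reflect n S \<inter> ?F) \<in> \<Lambda>}"
    by (intro Collect_cong) metis
  then have "card ?Y = ?c * 2 ^ (n + 1 - 2 * K)"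
    using card_subsets_by_fringes[OF assms] by simp
  moreover have "(2::real) ^ (n + 1) = 4 ^ K * 2 ^ (n + 1 - 2 * K)"
  proof -
    have "n + 1 = 2 * K + (n + 1 - 2 * K)" using assms by simp
    then have "(2::real) ^ (n + 1) = 2 ^ (2 * K) * 2 ^ (n + 1 - 2 * K)" by (metis power_add)
    then show ?thesis by (simp add: power_mult)
  qed
  ultimately have "fringe_prob K \<Lambda> = real (card ?Y) / 2 ^ (n + 1)"
    by (simp add: fringe_prob_def)
  then have "rho_fin n \<Lambda> - fringe_prob K \<Lambda> = (real (card ?X) - real (card ?Y)) / 2 ^ (n + 1)"
    by (simp add: rho_fin_def diff_divide_distrib)
  then have "\<bar>rho_fin n \<Lambda> - fringe_prob K \<Lambda>\<bar> = \<bar>real (card ?X) - real (card ?Y)\<bar> / 2 ^ (n + 1)"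
    by (simp add: abs_divide)
  also have "\<dots> \<le> tail K" using diff by (simp only: divide_le_eq) simp
  finally show ?thesis .
qed

section \<open>Convergence and countable additivity\<close>

text \<open>Cauchy criterion: all terms from 2K on lie within \<open>tail K\<close> of the single
  number \<open>fringe_prob K \<Lambda>\<close>.\<close>

lemma convergent_rho_fin: "convergent (\<lambda>n. rho_fin n \<Lambda>)"
proof (intro Cauchy_convergent CauchyI)
  fix e :: real assume "0 < e"
  then obtain K where K: "tail K < e / 2"
    using order_tendstoD(2)[OF tail_tendsto_0, of "e / 2"] by (auto simp: eventually_sequentially)
  have "norm (rho_fin m \<Lambda> - rho_fin n \<Lambda>) < e" if "m \<ge> 2 * K" "n \<ge> 2 * K" for m n
    using rho_fin_approx[OF that(1), of \<Lambda>] rho_fin_approx[OF that(2), of \<Lambda>] K by simp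
  then show "\<exists>M. \<forall>m\<ge>M. \<forall>n\<ge>M. norm (rho_fin m \<Lambda> - rho_fin n \<Lambda>) < e" by blast
qed

lemma rho_fin_tendsto_rho: "(\<lambda>n. rho_fin n \<Lambda>) \<longlonglongrightarrow> rho \<Lambda>"
  using convergent_rho_fin by (simp add: rho_def convergent_LIMSEQ_iff)

lemma rho_approx: "\<bar>rho \<Lambda> - fringe_prob K \<Lambda>\<bar> \<le> tail K"
proof (rule LIMSEQ_le_const2)
  show "(\<lambda>n. \<bar>rho_fin n \<Lambda> - fringe_prob K \<Lambda>\<bar>) \<longlonglongrightarrow> \<bar>rho \<Lambda> - fringe_prob K \<Lambda>\<bar>"
    by (intro tendsto_intros rho_fin_tendsto_rho)
  show "\<exists>N. \<forall>n\<ge>N. \<bar>rho_fin n \<Lambda> - fringe_prob K \<Lambda>\<bar> \<le> tail K"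
    using rho_fin_approx by blast
qed

lemma rho_mono:
  assumes "\<Lambda> \<subseteq> \<Lambda>'"
  shows "rho \<Lambda> \<le> rho \<Lambda>'"
proof (rule LIMSEQ_le[OF rho_fin_tendsto_rho rho_fin_tendsto_rho])
  have "rho_fin n \<Lambda> \<le> rho_fin n \<Lambda>'" for n
    unfolding rho_fin_def using assms
    by (intro divide_right_mono of_nat_mono card_mono) auto
  then show "\<exists>N. \<forall>n\<ge>N. rho_fin n \<Lambda> \<le> rho_fin n \<Lambda>'" by blast
qed

lemma rho_Un_disjoint:
  assumes "\<Lambda> \<inter> \<Lambda>' = {}"
  shows "rho (\<Lambda> \<union> \<Lambda>') = rho \<Lambda> + rho \<Lambda>'"
proof (rule LIMSEQ_unique[OF rho_fin_tendsto_rho])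
  have "rho_fin n (\<Lambda> \<union> \<Lambda>') = rho_fin n \<Lambda> + rho_fin n \<Lambda>'" for n
  proof -
    let ?X = "\<lambda>\<Lambda>. {S. S \<subseteq> {0..int n} \<and> missing n S \<in> \<Lambda>}"
    have "?X (\<Lambda> \<union> \<Lambda>') = ?X \<Lambda> \<union> ?X \<Lambda>'" by auto
    moreover have "card (?X \<Lambda> \<union> ?X \<Lambda>') = card (?X \<Lambda>) + card (?X \<Lambda>')"
      using assms by (intro card_Un_disjoint) auto
    ultimately show ?thesis by (simp add: rho_fin_def add_divide_distrib)
  qed
  then show "(\<lambda>n. rho_fin n (\<Lambda> \<union> \<Lambda>')) \<longlonglongrightarrow> rho \<Lambda> + rho \<Lambda>'"
    by (simp add: tendsto_add rho_fin_tendsto_rho)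
qed

lemma rho_empty: "rho {} = 0"
  using rho_Un_disjoint[of "{}" "{}"] by simp

lemma rho_finite:
  assumes "finite Y"
  shows "rho Y = (\<Sum>x\<in>Y. rho {x})"
  using assms
proof (induction Y rule: finite_induct)
  case (insert x Y)
  then show ?case using rho_Un_disjoint[of "{x}" Y] by simp
qed (simp add: rho_empty)

text \<open>Gives the fringe distribution finite support, so that no mass can escape to infinity in
  \<open>rho_has_sum\<close>.\<close>

lemma fringe_missing_le: "fringe_missing K A B \<in> {..2 * K} \<times> {..2 * K}"
proof -
  have "card ({0..<int K} - X) \<le> K" for X
    using card_mono[of "{0..<int K}" "{0..<int K} - X"] by simp
  from this[of "A + A"] this[of "B + B"] this[of "A + B"] show ?thesis
    by (simp add: fringe_missing_def)
qed

text \<open>Once a finite Y contains the part of \<Lambda> inside the support box,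
  \<open>fringe_prob K\<close> vanishes on \<Lambda> - Y. Since \<open>rho_approx\<close> has the
  same error for every set of pairs, \<open>rho (\<Lambda> - Y)\<close> is at most
  \<open>tail K\<close>.\<close>

lemma rho_has_sum: "((\<lambda>x. rho {x}) has_sum rho \<Lambda>) \<Lambda>"
  unfolding has_sum_def
proof (rule tendstoI)
  fix e :: real assume "0 < e"
  then obtain K where K: "tail K < e"
    using order_tendstoD(2)[OF tail_tendsto_0, of e] by (auto simp: eventually_sequentially)
  let ?Z = "\<Lambda> \<inter> {..2 * K} \<times> {..2 * K}"
  have "dist (\<Sum>x\<in>Y. rho {x}) (rho \<Lambda>) < e" if Y: "finite Y" "?Z \<subseteq> Y" "Y \<subseteq> \<Lambda>" for Y
  proof -
    have "fringe_missing K A B \<in> Y" if "fringe_missing K A B \<in> \<Lambda>" for A B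
      using that subsetD[OF Y(2) IntI[OF _ fringe_missing_le[of K A B]]] by metis
    then have "{(A, B). A \<subseteq> {0..<int K} \<and> B \<subseteq> {0..<int K} \<and> fringe_missing K A B \<in> \<Lambda> - Y} = {}"
      by blast
    then have "fringe_prob K (\<Lambda> - Y) = 0"
      unfolding fringe_prob_def by (simp only: card.empty of_nat_0 div_0)
    then have "\<bar>rho (\<Lambda> - Y)\<bar> < e" using rho_approx[of "\<Lambda> - Y" K] K by simp
    moreover have "rho \<Lambda> = rho Y + rho (\<Lambda> - Y)"
      using rho_Un_disjoint[of Y "\<Lambda> - Y"] Y(3) by (simp add: Un_absorb1)
    ultimately show ?thesis using rho_finite[OF Y(1)] by (simp add: dist_real_def)
  qed
  moreover have "finite ?Z" by simp
  ultimately show "\<forall>\<^sub>F Y in finite_subsets_at_top \<Lambda>. dist (\<Sum>x\<in>Y. rho {x}) (rho \<Lambda>) < e"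
    unfolding eventually_finite_subsets_at_top by (intro exI[of _ ?Z]) auto
qed

section \<open>Positivity from a pair of cofinite fringes\<close>

text \<open>Every x >= 2L is (x - L) + L with both summands at least L, so all gaps are below
  \<open>K\<close>.\<close>

lemma Diff_plus_cofinite:
  assumes "{int L..} \<subseteq> A" "{int L..} \<subseteq> B" "2 * L \<le> K"
  shows "{0..<int K} - (A + B) = {0..} - (A + B)"
proof -
  have "x \<in> A + B" if "int K \<le> x" for x
  proof -
    have "x - int L \<in> A" "int L \<in> B" using assms that by (auto intro!: subsetD[OF assms(1)])
    then have "(x - int L) + int L \<in> A + B" by (rule set_plus_intro)
    then show ?thesis by simp
  qed
  then have "x < int K" if "x \<notin> A + B" for x using that not_le by blast
  then show ?thesis by auto
qed

text \<open>At least half of the subsets T of {0..n} have a full middle. Shifting T by L and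
  attaching A on the left and reflected B on the right yields a subset of {0..n + 2L} with exactly
  the wanted gaps. At most \<open>4 ^ K\<close> sets T give the same result, so a fixed positive
  proportion of sets is reached.\<close>

lemma rho_pos_of_fringes:
  assumes nonneg: "A \<subseteq> {0..}" "B \<subseteq> {0..}"
    and cof: "{int L..} \<subseteq> A" "{int L..} \<subseteq> B"
    and s: "s = card ({0..} - (A + A)) + card ({0..} - (B + B))"
    and d: "d = 2 * card ({0..} - (A + B))"
  shows "rho {(s, d)} > 0"
proof -
  obtain K1 where K1: "tail K1 < 1 / 2"
    using order_tendstoD(2)[OF tail_tendsto_0, of "1 / 2"] by (auto simp: eventually_sequentially)
  \<comment> \<open>Exactly what keeps the middle full: the shift moves sums by 2L, and the range of
    differences grows by 2L at each end.\<close>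
  define K where "K = 2 * L + K1"
  let ?F = "{0..<int K}"
  have fm: "fringe_missing K A B = (s, d)"
    using Diff_plus_cofinite[OF cof(1) cof(1), of K] Diff_plus_cofinite[OF cof(2) cof(2), of K]
      Diff_plus_cofinite[OF cof, of K] by (simp add: fringe_missing_def s d K_def)
  have "1 / (4 ^ K * 2 ^ (2 * L + 1)) \<le> rho_fin N {(s, d)}" if N: "N \<ge> 2 * K + 2 * L" for N
  proof -
    define n where "n = N - 2 * L"
    have n: "N = n + 2 * L" "2 * K \<le> n" using N by (auto simp: n_def)
    let ?G = "{T. T \<subseteq> {0..int n} \<and> middle_full K1 n T}"
    let ?X = "{S. S \<subseteq> {0..int N} \<and> missing N S \<in> {(s, d)}}"
    define f where "f T = A \<inter> ?F \<union> (+) (int L) ` T \<union> reflect N (B \<inter> ?F)" for T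
    have mem_f: "x \<in> f T \<longleftrightarrow> x \<in> A \<and> x < int K \<or> x - int L \<in> T \<or> int N - x \<in> B \<and> int N - x < int K" for x T
    proof -
      have "x \<in> (+) (int L) ` T \<longleftrightarrow> x - int L \<in> T"
        by (auto intro: image_eqI[of _ _ "x - int L"])
      then show ?thesis using nonneg by (auto simp: f_def mem_reflect_iff)
    qed
    have f_in: "f T \<in> ?X" if T: "T \<in> ?G" for T
    proof -
      have T0: "0 \<le> x \<and> x \<le> int n" if "x \<in> T" for x using T that by auto
      have A0: "0 \<le> x" if "x \<in> A" for x using nonneg that by auto
      have B0: "0 \<le> x" if "x \<in> B" for x using nonneg that by auto
      have sub: "f T \<subseteq> {0..int N}"
        using n by (auto simp: mem_f K_def dest!: T0 A0 B0)
      \<comment> \<open>The shifted T starts at L, from where A is full, so it adds nothing to the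
        fringe. The right end is symmetric: the shifted T ends at N - L.\<close>
      have left: "f T \<inter> ?F = A \<inter> ?F"
      proof -
        have "x \<in> A" if "x - int L \<in> T" for x
          using T0[OF that] cof(1) by auto
        then show ?thesis using n by (auto simp: mem_f dest: A0 B0)
      qed
      have right: "reflect N (f T) \<inter> ?F = B \<inter> ?F"
      proof -
        have "x \<in> B" if "int N - x - int L \<in> T" for x
          using T0[OF that] cof(2) n by auto
        then show ?thesis using n by (auto simp: mem_f mem_reflect_iff dest: A0 B0)
      qed
      have "middle_full K N (f T)"
        unfolding middle_full_def
      proof (intro conjI subsetI)
        fix k assume k: "k \<in> {int K..2 * int N - int K}"
        then have "k - 2 * int L \<in> {int K1..2 * int n - int K1}" using n by (auto simp: K_def)
        then have "k - 2 * int L \<in> sumset T" using T by (auto simp: middle_full_def)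
        then obtain x y where "k - 2 * int L = x + y" "x \<in> T" "y \<in> T" by (auto simp: sumset_def)
        then have "k = (x + int L) + (y + int L)" "x + int L \<in> f T" "y + int L \<in> f T"
          by (auto simp: mem_f)
        then show "k \<in> sumset (f T)" unfolding sumset_def by blast
      next
        fix k assume k: "k \<in> {int K - int N..int N - int K}"
        then have "k \<in> {int K1 - int n..int n - int K1}" using n by (auto simp: K_def)
        then have "k \<in> diffset T" using T by (auto simp: middle_full_def)
        then obtain x y where "k = x - y" "x \<in> T" "y \<in> T" by (auto simp: diffset_def)
        then have "k = (x + int L) - (y + int L)" "x + int L \<in> f T" "y + int L \<in> f T"
          by (auto simp: mem_f)
        then show "k \<in> diffset (f T)" unfolding diffset_def by blast
      qed
      then have "missing N (f T) = fringe_missing K (f T) (reflect N (f T))"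
        using sub n by (intro missing_eq_fringe_missing) auto
      also have "\<dots> = fringe_missing K A B"
        using sub nonneg left right
        by (intro fringe_missing_cong) (auto simp: mem_reflect_iff)
      finally show ?thesis using sub fm by simp
    qed
    have "card ?G \<le> card (?X \<times> Pow ?F \<times> Pow {int n - int K<..int n})"
    proof (rule card_inj_on_le)
      \<comment> \<open>Only elements of T that land in a fringe are hidden in \<open>f T\<close>;
        they are among the first or last K positions of {0..n}, which the other two components
        record.\<close>
      show "inj_on (\<lambda>T. (f T, T \<inter> ?F, T \<inter> {int n - int K<..int n})) ?G"
      proof (rule inj_onI)
        fix T T' assume T: "T \<in> ?G" "T' \<in> ?G"
          and eq: "(f T, T \<inter> ?F, T \<inter> {int n - int K<..int n}) = (f T', T' \<inter> ?F, T' \<inter> {int n - int K<..int n})"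
        have "x \<in> T \<longleftrightarrow> x \<in> T'" for x
        proof -
          consider "x < 0 \<or> int n < x" | "x \<in> ?F" | "x \<in> {int n - int K<..int n}"
            | "x + int L \<ge> int K" "int N - (x + int L) \<ge> int K"
            using n by force
          then show ?thesis
          proof cases
            case 1 then show ?thesis using T by auto
          next
            case 2 then show ?thesis using eq by blast
          next
            case 3 then show ?thesis using eq by blast
          next
            case 4
            then have "x + int L \<in> f T \<longleftrightarrow> x \<in> T" "x + int L \<in> f T' \<longleftrightarrow> x \<in> T'"
              by (auto simp: mem_f)
            then show ?thesis using eq by simp
          qed
        qed
        then show "T = T'" by blast
      qed
      show "(\<lambda>T. (f T, T \<inter> ?F, T \<inter> {int n - int K<..int n})) ` ?G \<subseteq> ?X \<times> Pow ?F \<times> Pow {int n - int K<..int n}"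
        using f_in by blast
    qed simp
    also have "\<dots> = card ?X * 4 ^ K"
    proof -
      have "(4::nat) ^ K = 2 ^ K * 2 ^ K" by (simp flip: power_mult_distrib)
      then show ?thesis by (simp only: card_cartesian_product card_Pow finite_atLeastLessThan_int
            finite_greaterThanAtMost_int card_atLeastLessThan_int card_greaterThanAtMost_int) simp
    qed
    finally have "real (card ?G) \<le> real (card ?X * 4 ^ K)" by (rule of_nat_mono)
    then have G_le: "real (card ?G) \<le> real (card ?X) * 4 ^ K"
      by (simp only: of_nat_mult of_nat_power of_nat_numeral)
    have "2 ^ (n + 1) = real (card (Pow {0..int n}))" by (simp add: card_Pow nat_add_distrib)
    also have "Pow {0..int n} = ?G \<union> {T. T \<subseteq> {0..int n} \<and> \<not> middle_full K1 n T}" by auto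
    also have "real (card \<dots>) \<le> real (card ?G) + real (card {T. T \<subseteq> {0..int n} \<and> \<not> middle_full K1 n T})"
      by (simp only: card_Un_le of_nat_le_iff flip: of_nat_add)
    also have "\<dots> \<le> real (card ?G) + tail K1 * 2 ^ (n + 1)"
      using card_not_middle_full_le by simp
    also have "\<dots> \<le> real (card ?G) + 1 / 2 * 2 ^ (n + 1)"
      using K1 by (intro add_left_mono mult_right_mono) auto
    finally have "2 ^ n \<le> real (card ?G)" by simp
    with G_le have le: "2 ^ n \<le> real (card ?X) * 4 ^ K" by linarith
    have "1 / (4 ^ K * 2 ^ (2 * L + 1)) = (2::real) ^ n / (4 ^ K * (2 ^ n * 2 ^ (2 * L + 1)))" by simp
    also have "\<dots> \<le> real (card ?X) * 4 ^ K / (4 ^ K * (2 ^ n * 2 ^ (2 * L + 1)))"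
      using le by (rule divide_right_mono) simp
    also have "\<dots> = real (card ?X) / (2 ^ n * 2 ^ (2 * L + 1))" by simp
    also have "\<dots> = rho_fin N {(s, d)}"
      by (simp add: rho_fin_def n power_add)
    finally show ?thesis .
  qed
  then have "1 / (4 ^ K * 2 ^ (2 * L + 1)) \<le> rho {(s, d)}"
    by (intro LIMSEQ_le_const[OF rho_fin_tendsto_rho]) blast
  moreover have "(0::real) < 1 / (4 ^ K * 2 ^ (2 * L + 1))" by simp
  ultimately show ?thesis by linarith
qed

section \<open>Gap counts realized by cofinite fringes\<close>

text \<open>Here e is half the number of missing differences.\<close>

definition realizable :: "nat \<Rightarrow> nat \<Rightarrow> bool" where
  "realizable s e \<longleftrightarrow> (\<exists>L A B. A \<subseteq> {0..} \<and> B \<subseteq> {0..} \<and> {int L..} \<subseteq> A \<and> {int L..} \<subseteq> B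
    \<and> s = card ({0..} - (A + A)) + card ({0..} - (B + B)) \<and> e = card ({0..} - (A + B)))"

lemma realizableI:
  assumes "A \<subseteq> {0..}" "B \<subseteq> {0..}" "{int L..} \<subseteq> A" "{int L..} \<subseteq> B"
    and "s = card ({0..} - (A + A)) + card ({0..} - (B + B))" "e = card ({0..} - (A + B))"
  shows "realizable s e"
  using assms unfolding realizable_def by blast

lemma finite_Diff_plus_cofinite:
  fixes A B :: "int set"
  assumes "{int L..} \<subseteq> A" "{int L..} \<subseteq> B"
  shows "finite ({0..} - (A + B))"
  unfolding Diff_plus_cofinite[OF assms order.refl, symmetric] by simp

text \<open>Replacing B by q + B creates 2q new gaps in B + B and q in A + B, and leaves A + A
  alone.\<close>

lemma realizable_shift:
  assumes "realizable s e"
  shows "realizable (s + 2 * q) (e + q)"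
proof -
  from assms obtain L A B where AB: "A \<subseteq> {0..}" "B \<subseteq> {0..}" "{int L..} \<subseteq> A" "{int L..} \<subseteq> B"
    and s: "s = card ({0..} - (A + A)) + card ({0..} - (B + B))"
    and e: "e = card ({0..} - (A + B))"
    unfolding realizable_def by blast
  have mem: "x \<in> (+) (int q) ` X \<longleftrightarrow> x - int q \<in> X" for X x q
    by (auto intro: image_eqI[of _ _ "x - int q"])
  have shift: "card ({0..} - (+) (int q) ` X) = card ({0..} - X) + q"
    if "X \<subseteq> {0..}" "finite ({0..} - X)" for X q
  proof -
    have "{0..} - (+) (int q) ` X = (+) (int q) ` ({0..} - X) \<union> {0..<int q}"
      using that(1) by (auto simp: mem)
    moreover have "card \<dots> = card ((+) (int q) ` ({0..} - X)) + card {0..<int q}"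
      using that(2) by (intro card_Un_disjoint) auto
    ultimately show ?thesis by (simp add: card_image)
  qed
  let ?B = "(+) (int q) ` B"
  have plus: "A + ?B = (+) (int q) ` (A + B)" "?B + ?B = (+) (int (2 * q)) ` (B + B)"
    by (force simp: set_plus_def)+
  have "X + Y \<subseteq> {0..}" if "X \<subseteq> {0..}" "Y \<subseteq> {0..}" for X Y :: "int set"
    using that by (fastforce simp: set_plus_def)
  then have "card ({0..} - (?B + ?B)) = card ({0..} - (B + B)) + 2 * q"
    "card ({0..} - (A + ?B)) = card ({0..} - (A + B)) + q"
    unfolding plus using AB finite_Diff_plus_cofinite[OF AB(4,4)] finite_Diff_plus_cofinite[OF AB(3,4)]
    by (intro shift; blast)+
  moreover have "?B \<subseteq> {0..}" "{int (L + q)..} \<subseteq> A" "{int (L + q)..} \<subseteq> ?B"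
  proof -
    show "?B \<subseteq> {0..}" using subsetD[OF AB(2)] by fastforce
    show "{int (L + q)..} \<subseteq> A" using AB(3) by auto
    show "{int (L + q)..} \<subseteq> ?B" by (auto simp: mem intro!: subsetD[OF AB(4)])
  qed
  ultimately show ?thesis using AB(1) s e
    by (intro realizableI[of A ?B "L + q"]) simp_all
qed

text \<open>{0} together with all integers above s is closed under addition and has the s gaps 1,
  ..., s; since it contains 0, adding all naturals fills everything.\<close>

lemma realizable_0: "realizable s 0"
proof -
  let ?A = "insert 0 {int s + 1..}" and ?B = "{0..} :: int set"
  have "?A + ?A = ?A"
    by (auto simp: set_plus_def)
  moreover have "{0..} - ?A = {1..int s}" by auto
  moreover have "0 + x \<in> X + ?B" if "0 \<in> X" "0 \<le> x" for x :: int and X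
    using that by (intro set_plus_intro) auto
  then have "{0..} - (?A + ?B) = {}" "{0..} - (?B + ?B) = {}" by auto
  ultimately have "card ({0..} - (?A + ?A)) = s" "card ({0..} - (?A + ?B)) = 0" "card ({0..} - (?B + ?B)) = 0"
    by (simp_all only: card_atLeastAtMost_int) simp_all
  then show ?thesis by (intro realizableI[of ?A ?B "s + 1"]) auto
qed

section \<open>Periodic fringes modulo 8\<close>

definition periodic_up_to :: "nat \<Rightarrow> int set \<Rightarrow> int set" where
  "periodic_up_to L P = {x. 0 \<le> x \<and> (x mod 8 \<in> P \<or> int L \<le> x)}"

text \<open>If t = p + q, then x = (p + (x - t)) + q, where x - t is a nonnegative multiple of 8.
  The sum t is taken in the integers and may exceed 7, hence the condition t <= x.\<close>

lemma mem_periodic_plus: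
  assumes "P \<subseteq> {0..<8}" "Q \<subseteq> {0..<8}" "t \<in> P + Q" "t \<le> x" "x mod 8 = t mod 8"
  shows "x \<in> periodic_up_to L P + periodic_up_to L Q"
proof -
  from assms(3) obtain p q where pq: "t = p + q" "p \<in> P" "q \<in> Q" by (auto simp: set_plus_def)
  have p: "0 \<le> p" "p < 8" and q: "0 \<le> q" "q < 8" using pq assms(1,2) by auto
  have "8 dvd x - t" using assms(5) by (simp add: mod_eq_dvd_iff)
  then have "(p + (x - t)) mod 8 = p" using p by (simp add: mod_add_right_eq[symmetric, of _ "x - t"] mod_0_imp_dvd)
  then have "p + (x - t) \<in> periodic_up_to L P" "q \<in> periodic_up_to L Q"
    using p q pq assms(4) by (auto simp: periodic_up_to_def)
  then have "p + (x - t) + q \<in> periodic_up_to L P + periodic_up_to L Q" by (rule set_plus_intro)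
  then show ?thesis by (simp add: pq(1))
qed

text \<open>Both summands of an x below L are below L themselves, where membership is decided by
  residues alone.\<close>

lemma not_mem_periodic_plus:
  assumes "\<And>p q. p \<in> P \<Longrightarrow> q \<in> Q \<Longrightarrow> (p + q) mod 8 \<noteq> x mod 8" "x < int L"
  shows "x \<notin> periodic_up_to L P + periodic_up_to L Q"
proof
  assume "x \<in> periodic_up_to L P + periodic_up_to L Q"
  then obtain a b where ab: "x = a + b" "a \<in> periodic_up_to L P" "b \<in> periodic_up_to L Q"
    by (auto simp: set_plus_def)
  then have "a mod 8 \<in> P" "b mod 8 \<in> Q" using assms(2) by (auto simp: periodic_up_to_def)
  from assms(1)[OF this] show False by (simp add: ab(1) mod_add_eq)
qed

text \<open>The cutoff 8e + r + 1 comes right after the (e + 1)-st nonnegative integer congruent to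
  r, so A + B has the gaps r, r + 8, ..., r + 8e. The inclusions for Q + Q and P + Q hold in the
  integers without wrap-around, so no further small gaps arise.\<close>

lemma realizable_periodic:
  assumes PQ: "P \<subseteq> {0..<8}" "Q \<subseteq> {0..<8}" "0 \<in> P" "0 \<in> Q"
    and P: "card ({0..} - (periodic_up_to (8 * e + r + 1) P + periodic_up_to (8 * e + r + 1) P)) = s"
    and Q: "{0..<8} \<subseteq> Q + Q"
    and r: "r < 8" "{0..<8} - {int r} \<subseteq> P + Q"
      "\<And>p q. p \<in> P \<Longrightarrow> q \<in> Q \<Longrightarrow> (p + q) mod 8 \<noteq> int r"
  shows "realizable s (Suc e)"
proof -
  let ?L = "8 * e + r + 1"
  let ?A = "periodic_up_to ?L P" and ?B = "periodic_up_to ?L Q"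
  have "x \<in> ?B + ?B" if "0 \<le> x" for x
    using that Q by (intro mem_periodic_plus[OF PQ(2,2), of "x mod 8"]) (auto simp: zmod_le_nonneg_dividend)
  then have "{0..} - (?B + ?B) = {}" by auto
  then have B: "card ({0..} - (?B + ?B)) = 0" by (simp only: card.empty)
  have "x \<in> ?A + ?B \<longleftrightarrow> \<not> (x mod 8 = int r \<and> x < int ?L)" if "0 \<le> x" for x
  proof (cases "x mod 8 = int r")
    case False
    then have "x \<in> ?A + ?B" using that r(2)
      by (intro mem_periodic_plus[OF PQ(1,2), of "x mod 8"]) (auto simp: zmod_le_nonneg_dividend)
    then show ?thesis using False by simp
  next
    case True
    show ?thesis
    proof (cases "x < int ?L")
      case False
      \<comment> \<open>From the cutoff on, \<open>?A\<close> is full and adding 0 suffices.\<close>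
      then have "x \<in> ?A" "0 \<in> ?B" using that PQ(4) by (auto simp: periodic_up_to_def)
      then have "x + 0 \<in> ?A + ?B" by (rule set_plus_intro)
      then show ?thesis using False by simp
    next
      case less: True
      have "x \<notin> ?A + ?B" using r(3) True less by (intro not_mem_periodic_plus) auto
      then show ?thesis using less True by simp
    qed
  qed
  then have "{0..} - (?A + ?B) = {x. 0 \<le> x \<and> x mod 8 = int r \<and> x < int ?L}" by auto
  also have "\<dots> = (\<lambda>i. int r + 8 * int i) ` {..e}"
  proof (intro set_eqI iffI)
    fix x assume x: "x \<in> {x. 0 \<le> x \<and> x mod 8 = int r \<and> x < int ?L}"
    then have "x = int r + 8 * int (nat (x div 8))" "nat (x div 8) \<le> e"
      using mod_mult_div_eq[of x 8] by auto
    then show "x \<in> (\<lambda>i. int r + 8 * int i) ` {..e}" by blast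
  qed (use r(1) in auto)
  also have "card \<dots> = Suc e" by (subst card_image) (auto simp: inj_on_def)
  finally have AB: "card ({0..} - (?A + ?B)) = Suc e" .
  have "?A \<subseteq> {0..}" "?B \<subseteq> {0..}" "{int ?L..} \<subseteq> ?A" "{int ?L..} \<subseteq> ?B"
    by (auto simp: periodic_up_to_def)
  then show ?thesis using P AB
    by (intro realizableI[of ?A ?B ?L]) (simp_all only: P AB B add_0_right)
qed

lemma interval_8: "{0..<8} = {0, 1, 2, 3, 4, 5, 6, 7 :: int}" by auto

text \<open>Modulo 8, P + Q avoids r exactly when P is disjoint from r - Q. With Q = {0, 1, 2, 5}
  and r = 7, P is the full complement of r - Q.\<close>

lemma realizable_0_Suc: "realizable 0 (Suc e)"
proof (rule realizable_periodic[where r = 7])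
  let ?P = "{0, 1, 3, 4} :: int set"
  let ?L = "8 * e + 7 + 1"
  show "{0..<8} \<subseteq> {0, 1, 2, 5} + {0, 1, 2, 5 :: int}" "{0..<8} - {int 7} \<subseteq> ?P + {0, 1, 2, 5}"
    unfolding interval_8 by (auto simp: set_plus_def)
  have P: "{0..<8} \<subseteq> ?P + ?P"
    unfolding interval_8 by (auto simp: set_plus_def)
  have "x \<in> periodic_up_to ?L ?P + periodic_up_to ?L ?P" if "0 \<le> x" for x
    using that P by (intro mem_periodic_plus[of _ _ "x mod 8"]) (auto simp: zmod_le_nonneg_dividend)
  then have "{0..} - (periodic_up_to ?L ?P + periodic_up_to ?L ?P) = {}" by auto
  then show "card ({0..} - (periodic_up_to ?L ?P + periodic_up_to ?L ?P)) = 0"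
    by (simp only: card.empty)
qed auto

text \<open>Same Q, now with r = 6 and P the complement of r - Q modulo 8. In P + P the residue 1
  arises only as 9 = 2 + 7, so the integer 1 is the only gap.\<close>

lemma realizable_1_Suc: "realizable 1 (Suc e)"
proof (rule realizable_periodic[where r = 6])
  let ?P = "{0, 2, 3, 7} :: int set"
  let ?L = "8 * e + 6 + 1"
  let ?A = "periodic_up_to ?L ?P"
  show "{0..<8} \<subseteq> {0, 1, 2, 5} + {0, 1, 2, 5 :: int}" "{0..<8} - {int 6} \<subseteq> ?P + {0, 1, 2, 5}"
    unfolding interval_8 by (auto simp: set_plus_def)
  have P: "{0..<8} - {1} \<subseteq> ?P + ?P" "9 \<in> ?P + ?P"
    unfolding interval_8 by (auto simp: set_plus_def)
  have "x \<in> ?A + ?A" if "0 \<le> x" "x \<noteq> 1" for x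
  proof (cases "x mod 8 = 1")
    case True
    then have "9 \<le> x" using that by presburger
    then show ?thesis using True P(2) by (intro mem_periodic_plus[of _ _ 9]) auto
  next
    case False
    then show ?thesis using that P(1)
      by (intro mem_periodic_plus[of _ _ "x mod 8"]) (auto simp: zmod_le_nonneg_dividend)
  qed
  moreover have "1 \<notin> ?A + ?A"
  proof
    assume "1 \<in> ?A + ?A"
    then obtain a b where "1 = a + b" "a \<in> ?A" "b \<in> ?A" by (auto simp: set_plus_def)
    moreover from this have "a = 0 \<and> b = 1 \<or> a = 1 \<and> b = 0" by (auto simp: periodic_up_to_def)
    ultimately show False by (auto simp: periodic_up_to_def)
  qed
  ultimately have "{0..} - (?A + ?A) = {1}" by auto
  then show "card ({0..} - (?A + ?A)) = 1" by simp
qed auto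

section \<open>All pairs, and the conclusion\<close>

text \<open>Shifting preserves s - 2e. If this is nonnegative, the start is (s - 2e, 0); otherwise s
  div 2 < e, and the start is s mod 2 with the positive second entry e - s div 2.\<close>

lemma realizable_all: "realizable s e"
proof (cases "2 * e \<le> s")
  case True
  then show ?thesis using realizable_shift[OF realizable_0[of "s - 2 * e"], of e] by simp
next
  case False
  then obtain e' where e': "e = Suc e' + s div 2"
    by (metis add.commute add_Suc_right div_less_iff_less_mult less_imp_Suc_add mult.commute
        not_le zero_less_numeral)
  have "realizable (s mod 2) (Suc e')"
    using realizable_0_Suc[of e'] realizable_1_Suc[of e'] by (cases "even s") (auto simp: odd_iff_mod_2_eq_one)
  from realizable_shift[OF this, of "s div 2"] show ?thesis by (simp add: e')
qed

lemma rho_pos: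
  assumes "even d"
  shows "rho {(s, d)} > 0"
proof -
  obtain L A B where AB: "A \<subseteq> {0..}" "B \<subseteq> {0..}" "{int L..} \<subseteq> A" "{int L..} \<subseteq> B"
    "s = card ({0..} - (A + A)) + card ({0..} - (B + B))" "d div 2 = card ({0..} - (A + B))"
    using realizable_all[of s "d div 2"] unfolding realizable_def by blast
  moreover from AB(6) have "d = 2 * card ({0..} - (A + B))" using assms by presburger
  ultimately show ?thesis by (intro rho_pos_of_fringes)
qed

theorem theorem1p3:
  fixes \<Lambda> :: "(nat \<times> nat) set"
  shows "convergent (\<lambda>n. rho_fin n \<Lambda>)
    \<and> ((\<exists>(s, d) \<in> \<Lambda>. even d) \<longrightarrow> rho \<Lambda> > 0)
    \<and> ((\<lambda>(s, d). rho {(s, d)}) has_sum rho \<Lambda>) \<Lambda>"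
proof (intro conjI impI)
  assume "\<exists>(s, d) \<in> \<Lambda>. even d"
  then obtain s d where "(s, d) \<in> \<Lambda>" "even d" by blast
  then show "rho \<Lambda> > 0"
    using rho_pos[of d s] rho_mono[of "{(s, d)}" \<Lambda>] by simp
next
  have "(\<lambda>(s, d). rho {(s, d)}) = (\<lambda>x. rho {x})" by auto
  then show "((\<lambda>(s, d). rho {(s, d)}) has_sum rho \<Lambda>) \<Lambda>" using rho_has_sum by simp
qed (rule convergent_rho_fin)

end
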